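(* Let $\mathfrak{g}$ be a $4$-dimensional real Lie algebra with $B\wedge B=0$ (i.e. $u\wedge w=0$ for all $u,w\in B$), where $B\subset\Lambda^2(\mathfrak{g})$ is the space of boundary $2$-vectors. Let $J$ be an almost complex structure on $\mathfrak{g}$. The following are equivalent: 0) $J$ is tamed. 1) $B\cap PC_J=\{0\}$. 2) $B\cap\Lambda_J^+(\mathfrak{g})=\{0\}$. 3) $\pi_+B\cap PC_J=\{0\}$. 4) $J$ is almost Kähler.
   Context: $\Lambda^k(\mathfrak{g})$, $\Lambda^k(\mathfrak{g}^* )$ denote $k$-vectors and $k$-forms, with evaluation $\alpha(v_1\wedge\dots\wedge v_k)=\alpha(v_1,\dots,v_k)$. The differential $d$ on $\Lambda^*(\mathfrak{g}^* )$ is the Chevalley–Eilenberg differential, $d\phi(u,v)=-\phi([u,v])$ on $1$-forms. A $2$-vector $u$ is a boundary if there is $w\in\Lambda^3(\mathfrak{g})$ with $\varphi(u)=(d\varphi)(w)$ for all $\varphi\in\Lambda^2(\mathfrak{g}^* )$. An almost complex structure is a linear automorphism $J$ of $\mathfrak{g}$ with $J^2=-\mathrm{id}$; $\mathfrak{g}$ carries the orientation induced by $J$. $\Lambda_J^\pm(\mathfrak{g}^* )$ are the $\pm1$-eigenspaces of $\alpha(\cdot,\cdot)\mapsto\alpha(J\cdot,J\cdot)$ on $\Lambda^2(\mathfrak{g}^* )$, and $\Lambda_J^\pm(\mathfrak{g})$ are the $\pm1$-eigenspaces of the involution $u\wedge v\mapsto Ju\wedge Jv$ on $\Lambda^2(\mathfrak{g})$;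 $\pi_\pm:\Lambda^2(\mathfrak{g})\to\Lambda_J^\pm(\mathfrak{g})$ are the projections of $\Lambda^2(\mathfrak{g})=\Lambda_J^+(\mathfrak{g})\oplus\Lambda_J^-(\mathfrak{g})$. $PC_J\subset\Lambda_J^+(\mathfrak{g})$ is the convex cone of positive $2$-vectors, i.e. of finite convex combinations of $2$-vectors $v\wedge Jv$, $v\in\mathfrak{g}$ (it contains $0$). A closed $2$-form $\varphi$ is $J$-tamed if $\varphi(v\wedge Jv)>0$ for every nonzero $v\in\mathfrak{g}$, and $J$-compatible if moreover $\varphi\in\Lambda_J^+(\mathfrak{g}^* )$. $J$ is tamed (resp. almost Kähler) if there exists a $J$-tamed (resp. $J$-compatible) form. *)

theory Defs
  imports "HOL-Analysis.Analysis"
begin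

subsection \<open>Alternating forms\<close>

definition vupd :: "'a ^ 'k \<Rightarrow> 'k \<Rightarrow> 'a \<Rightarrow> 'a ^ 'k" where
  "vupd x i v = (\<chi> j. if j = i then v else x $ j)"

definition multilin :: "('a::real_vector ^ 'k \<Rightarrow> real) \<Rightarrow> bool" where
  "multilin \<alpha> \<longleftrightarrow> (\<forall>x i. linear (\<lambda>v. \<alpha> (vupd x i v)))"

definition alternating :: "('a ^ 'k \<Rightarrow> real) \<Rightarrow> bool" where
  "alternating \<alpha> \<longleftrightarrow> (\<forall>x i j. i \<noteq> j \<longrightarrow> x $ i = x $ j \<longrightarrow> \<alpha> x = 0)"

(* The degree of a form is the cardinality of the finite index type 'k. *)
typedef (overloaded) ('a::real_vector, 'k::finite) kform =
  "{\<alpha> :: 'a ^ 'k \<Rightarrow> real. multilin \<alpha> \<and> alternating \<alpha>}"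
  morphisms form_apply Abs_kform
proof
  show "(\<lambda>_. 0) \<in> {\<alpha> :: 'a ^ 'k \<Rightarrow> real. multilin \<alpha> \<and> alternating \<alpha>}"
    by (simp add: multilin_def alternating_def linear_zero)
qed

setup_lifting type_definition_kform

lemma linear_cmult:
  fixes f :: "'a::real_vector \<Rightarrow> real"
  shows "linear f \<Longrightarrow> linear (\<lambda>x. c * f x)"
  by (auto intro!: linearI simp: linear_add linear_scale algebra_simps)

instantiation kform :: (real_vector, finite) real_vector
begin

lift_definition zero_kform :: "('a, 'b) kform" is "\<lambda>_. 0"
  by (simp add: multilin_def alternating_def linear_zero)

lift_definition plus_kform :: "('a, 'b) kform \<Rightarrow> ('a, 'b) kform \<Rightarrow> ('a, 'b) kform"
  is "\<lambda>\<alpha> \<beta> x. \<alpha> x + \<beta> x"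
  by (simp add: multilin_def alternating_def linear_compose_add)

lift_definition uminus_kform :: "('a, 'b) kform \<Rightarrow> ('a, 'b) kform" is "\<lambda>\<alpha> x. - \<alpha> x"
  by (simp add: multilin_def alternating_def linear_compose_neg)

lift_definition minus_kform :: "('a, 'b) kform \<Rightarrow> ('a, 'b) kform \<Rightarrow> ('a, 'b) kform"
  is "\<lambda>\<alpha> \<beta> x. \<alpha> x - \<beta> x"
  by (simp add: multilin_def alternating_def linear_compose_sub)

lift_definition scaleR_kform :: "real \<Rightarrow> ('a, 'b) kform \<Rightarrow> ('a, 'b) kform"
  is "\<lambda>r \<alpha> x. r * \<alpha> x"
  by (simp add: multilin_def alternating_def linear_cmult)

instance
  by standard (transfer; simp add: algebra_simps fun_eq_iff)+

end

subsection \<open>Exterior powers\<close>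

(* Two finite formal sums of decomposable k-vectors define the same element of the k-th exterior
   power iff every alternating k-form takes the same value on them (forms separate points, since
   the scalars are a field). So the exterior power is realised inside the functions on k-forms, as
   the finite linear combinations of the evaluations at k-tuples of vectors. *)
definition ext_power :: "(('a::real_vector, 'k::finite) kform \<Rightarrow> real) set" where
  "ext_power = {u. \<exists>(S :: ('a ^ 'k) set) c. finite S \<and> u = (\<lambda>\<alpha>. \<Sum>x\<in>S. c x * form_apply \<alpha> x)}"

lemma ext_power_0: "(\<lambda>_. 0) \<in> ext_power"
  unfolding ext_power_def by (rule CollectI, rule exI[of _ "{}"]) simp

lemma ext_power_scale: "u \<in> ext_power \<Longrightarrow> (\<lambda>\<alpha>. r * u \<alpha>) \<in> ext_power"
proof -
  assume "u \<in> ext_power"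
  then obtain S c where "finite S" "u = (\<lambda>\<alpha>. \<Sum>x\<in>S. c x * form_apply \<alpha> x)"
    by (auto simp: ext_power_def)
  then show ?thesis
    unfolding ext_power_def
    by (intro CollectI exI[of _ S] exI[of _ "\<lambda>x. r * c x"]) (simp add: sum_distrib_left mult.assoc)
qed

lemma ext_power_add:
  fixes u w :: "('a::real_vector, 'k::finite) kform \<Rightarrow> real"
  assumes "u \<in> ext_power" "w \<in> ext_power"
  shows "(\<lambda>\<alpha>. u \<alpha> + w \<alpha>) \<in> ext_power"
proof -
  obtain S c where S: "finite S" "u = (\<lambda>\<alpha>. \<Sum>x\<in>S. c x * form_apply \<alpha> x)"
    using assms by (auto simp: ext_power_def)
  obtain T d where T: "finite T" "w = (\<lambda>\<alpha>. \<Sum>x\<in>T. d x * form_apply \<alpha> x)"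
    using assms by (auto simp: ext_power_def)
  define e where "e x = (if x \<in> S then c x else 0) + (if x \<in> T then d x else 0)" for x
  have "u \<alpha> + w \<alpha> = (\<Sum>x\<in>S \<union> T. e x * form_apply \<alpha> x)" for \<alpha>
  proof -
    have "u \<alpha> = (\<Sum>x\<in>S \<union> T. (if x \<in> S then c x else 0) * form_apply \<alpha> x)"
      unfolding S(2) by (rule sum.mono_neutral_cong_left) (use S T in auto)
    moreover have "w \<alpha> = (\<Sum>x\<in>S \<union> T. (if x \<in> T then d x else 0) * form_apply \<alpha> x)"
      unfolding T(2) by (rule sum.mono_neutral_cong_left) (use S T in auto)
    ultimately show ?thesis
      by (simp add: e_def sum.distrib distrib_right)
  qed
  then show ?thesis
    using S(1) T(1) unfolding ext_power_def by (intro CollectI exI[of _ "S \<union> T"] exI[of _ e]) auto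
qed

lemma ext_power_eval: "(\<lambda>\<alpha>. form_apply \<alpha> x) \<in> ext_power"
  unfolding ext_power_def
  by (intro CollectI exI[of _ "{x}"] exI[of _ "\<lambda>_. 1"]) simp

lemma ext_power_sum:
  assumes "finite I" "\<And>i. i \<in> I \<Longrightarrow> u i \<in> ext_power"
  shows "(\<lambda>\<alpha>. \<Sum>i\<in>I. u i \<alpha>) \<in> ext_power"
  using assms by (induction I rule: finite_induct) (auto intro: ext_power_0 ext_power_add)

typedef (overloaded) ('a::real_vector, 'k::finite) kvec =
  "ext_power :: (('a, 'k) kform \<Rightarrow> real) set"
  morphisms vec_pair Abs_kvec
  using ext_power_0 by blast

setup_lifting type_definition_kvec

instantiation kvec :: (real_vector, finite) real_vector
begin

lift_definition zero_kvec :: "('a, 'b) kvec" is "\<lambda>_. 0"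
  by (rule ext_power_0)

lift_definition plus_kvec :: "('a, 'b) kvec \<Rightarrow> ('a, 'b) kvec \<Rightarrow> ('a, 'b) kvec"
  is "\<lambda>u w \<alpha>. u \<alpha> + w \<alpha>"
  by (rule ext_power_add)

lift_definition uminus_kvec :: "('a, 'b) kvec \<Rightarrow> ('a, 'b) kvec" is "\<lambda>u \<alpha>. - u \<alpha>"
  using ext_power_scale[of _ "-1"] by simp

lift_definition minus_kvec :: "('a, 'b) kvec \<Rightarrow> ('a, 'b) kvec \<Rightarrow> ('a, 'b) kvec"
  is "\<lambda>u w \<alpha>. u \<alpha> - w \<alpha>"
  using ext_power_add[OF _ ext_power_scale[of _ "-1"]] by simp

lift_definition scaleR_kvec :: "real \<Rightarrow> ('a, 'b) kvec \<Rightarrow> ('a, 'b) kvec"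
  is "\<lambda>r u \<alpha>. r * u \<alpha>"
  by (rule ext_power_scale)

instance
  by standard (transfer; simp add: algebra_simps fun_eq_iff)+

end

abbreviation evaluate :: "('a::real_vector, 'k::finite) kform \<Rightarrow> ('a, 'k) kvec \<Rightarrow> real" where
  "evaluate \<alpha> u \<equiv> vec_pair u \<alpha>"

(* blade x is the decomposable k-vector x_1 /\ ... /\ x_k. *)
lift_definition blade :: "'a::real_vector ^ 'k \<Rightarrow> ('a, 'k::finite) kvec"
  is "\<lambda>x \<alpha>. form_apply \<alpha> x"
  by (rule ext_power_eval)

lemma evaluate_blade: "evaluate \<alpha> (blade x) = form_apply \<alpha> x"
  by transfer simp

subsection \<open>The wedge product of multivectors\<close>

definition vjoin :: "'a ^ 'k \<Rightarrow> 'a ^ 'l \<Rightarrow> 'a ^ ('k + 'l)" where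
  "vjoin x y = (\<chi> s. case s of Inl i \<Rightarrow> x $ i | Inr j \<Rightarrow> y $ j)"

lemma vjoin_vupd:
  "vjoin (vupd x i v) y = vupd (vjoin x y) (Inl i) v"
  "vjoin x (vupd y j v) = vupd (vjoin x y) (Inr j) v"
  by (auto simp: vjoin_def vupd_def vec_eq_iff split: sum.split)

lemma form_apply_linear: "linear (\<lambda>v. form_apply \<alpha> (vupd x i v))"
  and form_apply_alt: "i \<noteq> j \<Longrightarrow> x $ i = x $ j \<Longrightarrow> form_apply \<alpha> x = 0"
  using form_apply[of \<alpha>] unfolding multilin_def alternating_def by blast+

lift_definition slice ::
  "('a::real_vector, 'k::finite + 'l::finite) kform \<Rightarrow> 'a ^ 'k \<Rightarrow> ('a, 'l) kform"
  is "\<lambda>\<alpha> x y. \<alpha> (vjoin x y)"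
proof -
  fix \<alpha> :: "'a ^ ('k + 'l) \<Rightarrow> real" and x :: "'a ^ 'k"
  assume "multilin \<alpha> \<and> alternating \<alpha>"
  then have lin: "linear (\<lambda>v. \<alpha> (vupd z s v))" and
    alt: "s \<noteq> t \<Longrightarrow> z $ s = z $ t \<Longrightarrow> \<alpha> z = 0" for z s t
    by (auto simp: multilin_def alternating_def)
  have "multilin (\<lambda>y. \<alpha> (vjoin x y))"
    by (simp add: multilin_def vjoin_vupd lin)
  moreover have "alternating (\<lambda>y. \<alpha> (vjoin x y))"
    unfolding alternating_def
  proof (intro allI impI)
    fix y :: "'a ^ 'l" and i j
    assume "i \<noteq> j" "y $ i = y $ j"
    then show "\<alpha> (vjoin x y) = 0"
      by (intro alt[of "Inr i" "Inr j"]) (auto simp: vjoin_def)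
  qed
  ultimately show "multilin (\<lambda>y. \<alpha> (vjoin x y)) \<and> alternating (\<lambda>y. \<alpha> (vjoin x y))" ..
qed

lemma vec_pair_sum:
  obtains S c where "finite S" "\<And>\<alpha>. vec_pair u \<alpha> = (\<Sum>x\<in>S. c x * form_apply \<alpha> x)"
  using vec_pair[of u] unfolding ext_power_def by auto

lift_definition contract ::
  "('a::real_vector, 'k::finite + 'l::finite) kform \<Rightarrow> ('a, 'l) kvec \<Rightarrow> ('a, 'k) kform"
  is "\<lambda>\<alpha> w x. vec_pair w (slice \<alpha> x)"
proof -
  fix \<alpha> :: "('a, 'k + 'l) kform" and w :: "('a, 'l) kvec"
  obtain S c where S: "finite S" "\<And>\<alpha>. vec_pair w \<alpha> = (\<Sum>x\<in>S. c x * form_apply \<alpha> x)"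
    using vec_pair_sum[of w] by metis
  have eq: "vec_pair w (slice \<alpha> x) = (\<Sum>y\<in>S. c y * form_apply \<alpha> (vjoin x y))" for x
    by (simp add: S(2) slice.rep_eq)
  have "multilin (\<lambda>x. vec_pair w (slice \<alpha> x))"
    unfolding multilin_def eq vjoin_vupd
    using S(1) by (auto intro!: linear_compose_sum linear_cmult form_apply_linear)
  moreover have "alternating (\<lambda>x. vec_pair w (slice \<alpha> x))"
    unfolding alternating_def eq
  proof (intro allI impI sum.neutral ballI)
    fix x :: "'a ^ 'k" and i j y
    assume "i \<noteq> j" "x $ i = x $ j"
    then have "form_apply \<alpha> (vjoin x y) = 0"
      by (intro form_apply_alt[of "Inl i" "Inl j"]) (auto simp: vjoin_def)
    then show "c y * form_apply \<alpha> (vjoin x y) = 0" by simp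
  qed
  ultimately show "multilin (\<lambda>x. vec_pair w (slice \<alpha> x)) \<and> alternating (\<lambda>x. vec_pair w (slice \<alpha> x))" ..
qed

lift_definition kwedge ::
  "('a::real_vector, 'k::finite) kvec \<Rightarrow> ('a, 'l::finite) kvec \<Rightarrow> ('a, 'k + 'l) kvec"
  is "\<lambda>u w \<alpha>. u (contract \<alpha> (Abs_kvec w))"
proof -
  fix u :: "('a, 'k) kform \<Rightarrow> real" and w :: "('a, 'l) kform \<Rightarrow> real"
  assume u: "u \<in> ext_power" and w: "w \<in> ext_power"
  obtain S c where S: "finite S" "u = (\<lambda>\<alpha>. \<Sum>x\<in>S. c x * form_apply \<alpha> x)"
    using u by (auto simp: ext_power_def)
  obtain T d where T: "finite T" "w = (\<lambda>\<alpha>. \<Sum>x\<in>T. d x * form_apply \<alpha> x)"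
    using w by (auto simp: ext_power_def)
  have eq: "u (contract \<alpha> (Abs_kvec w)) =
      (\<Sum>x\<in>S. c x * (\<Sum>y\<in>T. d y * form_apply \<alpha> (vjoin x y)))" for \<alpha> :: "('a, 'k + 'l) kform"
    by (simp add: S(2) contract.rep_eq Abs_kvec_inverse[OF w]) (simp add: T(2) slice.rep_eq)
  show "(\<lambda>\<alpha>. u (contract \<alpha> (Abs_kvec w))) \<in> ext_power"
    unfolding eq
    by (intro ext_power_sum ext_power_scale ext_power_eval S T)
qed

lemma kwedge_pair: "vec_pair (kwedge u w) \<alpha> = vec_pair u (contract \<alpha> w)"
  by (simp add: kwedge.rep_eq vec_pair_inverse)

lemma kwedge_blade: "kwedge (blade x) (blade y) = blade (vjoin x y)"
  by (rule vec_pair_inject[THEN iffD1])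
    (simp add: fun_eq_iff kwedge_pair blade.rep_eq contract.rep_eq slice.rep_eq)

lemma kwedge_bilinear:
  "kwedge (u + u') w = kwedge u w + kwedge u' w"
  "kwedge (r *\<^sub>R u) w = r *\<^sub>R kwedge u w"
  "kwedge u (w + w') = kwedge u w + kwedge u w'"
  "kwedge u (r *\<^sub>R w) = r *\<^sub>R kwedge u w"
proof -
  have 1: "contract \<alpha> (w + w') = contract \<alpha> w + contract \<alpha> w'" for \<alpha> :: "('a, 'b + 'c) kform"
    by (rule form_apply_inject[THEN iffD1])
      (simp add: fun_eq_iff contract.rep_eq plus_kform.rep_eq plus_kvec.rep_eq)
  have 2: "contract \<alpha> (r *\<^sub>R w) = r *\<^sub>R contract \<alpha> w" for \<alpha> :: "('a, 'b + 'c) kform"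
    by (rule form_apply_inject[THEN iffD1])
      (simp add: fun_eq_iff contract.rep_eq scaleR_kform.rep_eq scaleR_kvec.rep_eq)
  obtain S c where S: "finite S" "\<And>\<alpha>. vec_pair u \<alpha> = (\<Sum>x\<in>S. c x * form_apply \<alpha> x)"
    using vec_pair_sum[of u] by metis
  show "kwedge (u + u') w = kwedge u w + kwedge u' w"
    by (rule vec_pair_inject[THEN iffD1])
      (simp add: fun_eq_iff kwedge_pair plus_kvec.rep_eq)
  show "kwedge (r *\<^sub>R u) w = r *\<^sub>R kwedge u w"
    by (rule vec_pair_inject[THEN iffD1])
      (simp add: fun_eq_iff kwedge_pair scaleR_kvec.rep_eq)
  show "kwedge u (w + w') = kwedge u w + kwedge u w'"
    by (rule vec_pair_inject[THEN iffD1])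
      (simp add: fun_eq_iff kwedge_pair plus_kvec.rep_eq 1 S(2) plus_kform.rep_eq
        distrib_left sum.distrib)
  show "kwedge u (r *\<^sub>R w) = r *\<^sub>R kwedge u w"
    by (rule vec_pair_inject[THEN iffD1])
      (simp add: fun_eq_iff kwedge_pair scaleR_kvec.rep_eq 2 S(2) scaleR_kform.rep_eq
        sum_distrib_left mult.left_commute)
qed

subsection \<open>Functoriality\<close>

definition vmap :: "('a \<Rightarrow> 'b) \<Rightarrow> 'a ^ 'k \<Rightarrow> 'b ^ 'k" where
  "vmap f x = (\<chi> i. f (x $ i))"

(* The arguments of Abs_kform and Abs_kvec below lie in the represented sets when f is linear. *)
definition form_pullback ::
  "('a::real_vector \<Rightarrow> 'b::real_vector) \<Rightarrow> ('b, 'k::finite) kform \<Rightarrow> ('a, 'k) kform" where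
  "form_pullback f \<alpha> = Abs_kform (\<lambda>x. form_apply \<alpha> (vmap f x))"

definition vec_push ::
  "('a::real_vector \<Rightarrow> 'b::real_vector) \<Rightarrow> ('a, 'k::finite) kvec \<Rightarrow> ('b, 'k) kvec" where
  "vec_push f u = Abs_kvec (\<lambda>\<alpha>. vec_pair u (form_pullback f \<alpha>))"

lemma form_pullback_apply:
  assumes "linear f"
  shows "form_apply (form_pullback f \<alpha>) x = form_apply \<alpha> (vmap f x)"
proof -
  have "vmap f (vupd x i v) = vupd (vmap f x) i (f v)" for x :: "'a ^ 'c" and i v
    by (simp add: vmap_def vupd_def vec_eq_iff)
  then have "multilin (\<lambda>x. form_apply \<alpha> (vmap f x))"
    using linear_compose[OF assms form_apply_linear[of \<alpha>]] by (simp add: multilin_def o_def)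
  moreover have "alternating (\<lambda>x. form_apply \<alpha> (vmap f x))"
    by (auto simp: alternating_def vmap_def intro!: form_apply_alt)
  ultimately show ?thesis
    by (simp add: form_pullback_def Abs_kform_inverse)
qed

lemma vec_push_pair:
  assumes "linear f"
  shows "vec_pair (vec_push f u) \<alpha> = vec_pair u (form_pullback f \<alpha>)"
proof -
  obtain S c where S: "finite S" "\<And>\<alpha>. vec_pair u \<alpha> = (\<Sum>x\<in>S. c x * form_apply \<alpha> x)"
    using vec_pair_sum[of u] by metis
  have "(\<lambda>\<alpha>. vec_pair u (form_pullback f \<alpha>)) \<in> ext_power"
    unfolding S(2) form_pullback_apply[OF assms]
    by (intro ext_power_sum ext_power_scale ext_power_eval S)
  then show ?thesis
    by (simp add: vec_push_def Abs_kvec_inverse)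
qed

lemma vec_push_blade: "linear f \<Longrightarrow> vec_push f (blade x) = blade (vmap f x)"
  by (rule vec_pair_inject[THEN iffD1])
    (simp add: fun_eq_iff vec_push_pair blade.rep_eq form_pullback_apply)

subsection \<open>Lie algebras\<close>

locale lie_algebra =
  fixes br :: "'a::real_vector \<Rightarrow> 'a \<Rightarrow> 'a"
  assumes bilinear_br: "bilinear br"
    and br_self: "br x x = 0"
    and jacobi: "br x (br y z) + br y (br z x) + br z (br x y) = 0"

(* Chevalley-Eilenberg differential on 2-forms: the extension, as a graded derivation, of
   d phi (u, v) = - phi [u, v] on 1-forms; lemma ce_d_wedge below. The argument of
   Abs_kform is a 3-form when br is a Lie bracket. *)
definition ce_d ::
  "('a::real_vector \<Rightarrow> 'a \<Rightarrow> 'a) \<Rightarrow> ('a, 2) kform \<Rightarrow> ('a, 3) kform" where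
  "ce_d br \<phi> = Abs_kform (\<lambda>x.
     - form_apply \<phi> (vector [br (x $ 1) (x $ 2), x $ 3])
     + form_apply \<phi> (vector [br (x $ 1) (x $ 3), x $ 2])
     - form_apply \<phi> (vector [br (x $ 2) (x $ 3), x $ 1]))"

definition closed_form :: "('a::real_vector \<Rightarrow> 'a \<Rightarrow> 'a) \<Rightarrow> ('a, 2) kform \<Rightarrow> bool" where
  "closed_form br \<phi> \<longleftrightarrow> ce_d br \<phi> = 0"

definition boundaries :: "('a::real_vector \<Rightarrow> 'a \<Rightarrow> 'a) \<Rightarrow> ('a, 2) kvec set" where
  "boundaries br = {u. \<exists>w :: ('a, 3) kvec. \<forall>\<phi>. evaluate \<phi> u = evaluate (ce_d br \<phi>) w}"

lemma vupd_vector2: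
  fixes a b v :: "'a::real_vector"
  shows "vupd (vector [a, b] :: 'a ^ 2) 1 v = vector [v, b]"
    and "vupd (vector [a, b] :: 'a ^ 2) 2 v = vector [a, v]"
  by (simp_all add: vupd_def vec_eq_iff forall_2)

lemma form2_linear:
  fixes \<phi> :: "('a::real_vector, 2) kform"
  shows "linear (\<lambda>v. form_apply \<phi> (vector [v, b]))" "linear (\<lambda>v. form_apply \<phi> (vector [a, v]))"
  using form_apply_linear[of \<phi> "vector [0, b]" 1] form_apply_linear[of \<phi> "vector [a, 0]" 2]
  by (simp_all add: vupd_vector2)

lemma form2_self: "form_apply (\<phi> :: ('a::real_vector, 2) kform) (vector [a, a]) = 0"
  by (rule form_apply_alt[of 1 2]) simp_all

lemma form2_swap:
  fixes \<phi> :: "('a::real_vector, 2) kform"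
  shows "form_apply \<phi> (vector [b, a]) = - form_apply \<phi> (vector [a, b])"
  using form2_self[of \<phi> "a + b"] form2_self[of \<phi> a] form2_self[of \<phi> b]
  by (simp add: linear_add[OF form2_linear(1)] linear_add[OF form2_linear(2)])

context lie_algebra
begin

lemma br_swap: "br y x = - br x y"
proof -
  have "br x y + br y x = 0"
    using br_self[of "x + y"]
    unfolding bilinear_ladd[OF bilinear_br] bilinear_radd[OF bilinear_br]
    by (simp add: br_self add.commute)
  then show ?thesis by (simp add: eq_neg_iff_add_eq_0 add.commute)
qed

lemma br_linear: "linear (br x)" "linear (\<lambda>x. br x y)"
  using bilinear_br by (auto simp: bilinear_def)

lemma ce_d_apply:
  "form_apply (ce_d br \<phi>) x =
     - form_apply \<phi> (vector [br (x $ 1) (x $ 2), x $ 3])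
     + form_apply \<phi> (vector [br (x $ 1) (x $ 3), x $ 2])
     - form_apply \<phi> (vector [br (x $ 2) (x $ 3), x $ 1])"
proof -
  let ?f = "\<lambda>x :: 'a ^ 3.
     - form_apply \<phi> (vector [br (x $ 1) (x $ 2), x $ 3])
     + form_apply \<phi> (vector [br (x $ 1) (x $ 3), x $ 2])
     - form_apply \<phi> (vector [br (x $ 2) (x $ 3), x $ 1])"
  note lin = form2_linear[of \<phi>] linear_compose[OF br_linear(1) form2_linear(1)[of \<phi>], unfolded o_def]
    linear_compose[OF br_linear(2) form2_linear(1)[of \<phi>], unfolded o_def]
  have "linear (\<lambda>v. ?f (vupd x i v))" for x i
    using exhaust_3[of i]
    by (elim disjE)
      (simp_all add: vupd_def, (intro linear_compose_add linear_compose_sub linear_compose_neg lin)+)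
  then have "multilin ?f" by (simp add: multilin_def)
  moreover have "alternating ?f"
    unfolding alternating_def
  proof (intro allI impI)
    fix x :: "'a ^ 3" and i j
    assume "i \<noteq> j" "x $ i = x $ j"
    then consider "x $ 1 = x $ 2" | "x $ 1 = x $ 3" | "x $ 2 = x $ 3"
      using exhaust_3[of i] exhaust_3[of j] by metis
    then show "?f x = 0"
    proof cases
      case 1
      then show ?thesis by (simp add: br_self linear_0[OF form2_linear(1)])
    next
      case 2
      then show ?thesis
        by (simp add: br_self br_swap[of "x $ 2" "x $ 3"] linear_0[OF form2_linear(1)]
            linear_neg[OF form2_linear(1)])
    next
      case 3
      then show ?thesis by (simp add: br_self linear_0[OF form2_linear(1)])
    qed
  qed
  ultimately have "form_apply (ce_d br \<phi>) = ?f"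
    unfolding ce_d_def by (intro Abs_kform_inverse) blast
  then show ?thesis by simp
qed

lemma ce_d_wedge:
  fixes \<alpha> \<beta> :: "'a \<Rightarrow> real"
  assumes "\<And>u v. form_apply \<phi> (vector [u, v]) = \<alpha> u * \<beta> v - \<alpha> v * \<beta> u"
  defines "d\<alpha> \<equiv> \<lambda>u v. - \<alpha> (br u v)" and "d\<beta> \<equiv> \<lambda>u v. - \<beta> (br u v)"
  shows "form_apply (ce_d br \<phi>) (vector [x, y, z]) =
    (d\<alpha> x y * \<beta> z - d\<alpha> x z * \<beta> y + d\<alpha> y z * \<beta> x)
    - (\<alpha> x * d\<beta> y z - \<alpha> y * d\<beta> x z + \<alpha> z * d\<beta> x y)"
  by (simp add: ce_d_apply assms algebra_simps)

end

subsection \<open>Almost complex structures\<close>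

definition almost_complex :: "('a::real_vector \<Rightarrow> 'a) \<Rightarrow> bool" where
  "almost_complex J \<longleftrightarrow> linear J \<and> bij J \<and> (\<forall>v. J (J v) = - v)"

definition Lambda_plus_forms :: "('a::real_vector \<Rightarrow> 'a) \<Rightarrow> ('a, 2) kform set" where
  "Lambda_plus_forms J = {\<alpha>. form_pullback J \<alpha> = \<alpha>}"

definition Lambda_plus :: "('a::real_vector \<Rightarrow> 'a) \<Rightarrow> ('a, 2) kvec set" where
  "Lambda_plus J = {u. vec_push J u = u}"

definition Lambda_minus :: "('a::real_vector \<Rightarrow> 'a) \<Rightarrow> ('a, 2) kvec set" where
  "Lambda_minus J = {u. vec_push J u = - u}"

definition proj_plus :: "('a::real_vector \<Rightarrow> 'a) \<Rightarrow> ('a, 2) kvec \<Rightarrow> ('a, 2) kvec" where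
  "proj_plus J u = (THE p. p \<in> Lambda_plus J \<and> (\<exists>m\<in>Lambda_minus J. u = p + m))"

lemma proj_plus_unique:
  assumes "almost_complex J"
  shows "\<exists>!p. p \<in> Lambda_plus J \<and> (\<exists>m\<in>Lambda_minus J. u = p + m)"
proof -
  have J: "linear J" and JJ: "\<And>v. J (J v) = - v"
    using assms by (auto simp: almost_complex_def)
  have eqI: "u = w" if "\<And>\<alpha>. vec_pair u \<alpha> = vec_pair w \<alpha>" for u w :: "('a, 2) kvec"
    using that vec_pair_inject[of u w] by (simp add: fun_eq_iff)
  note push = vec_push_pair[OF J] and pull = form_pullback_apply[OF J]
  have add: "vec_push J (u + w) = vec_push J u + vec_push J w" for u w :: "('a, 2) kvec"
    by (rule eqI) (simp add: push plus_kvec.rep_eq)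
  have scale: "vec_push J (r *\<^sub>R u) = r *\<^sub>R vec_push J u" for r and u :: "('a, 2) kvec"
    by (rule eqI) (simp add: push scaleR_kvec.rep_eq)
  have "form_pullback J (form_pullback J \<alpha>) = \<alpha>" for \<alpha> :: "('a, 2) kform"
  proof (rule form_apply_inject[THEN iffD1], rule ext)
    fix x :: "'a ^ 2"
    have x: "x = vector [x $ 1, x $ 2]" by (simp add: vec_eq_iff forall_2)
    have "vmap J (vmap J x) = vector [- x $ 1, - x $ 2]"
      by (simp add: vmap_def JJ vec_eq_iff forall_2)
    then have "form_apply (form_pullback J (form_pullback J \<alpha>)) x
        = form_apply \<alpha> (vector [- x $ 1, - x $ 2])"
      by (simp add: pull)
    also have "\<dots> = form_apply \<alpha> (vector [x $ 1, x $ 2])"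
      by (simp add: linear_neg[OF form2_linear(1)] linear_neg[OF form2_linear(2)])
    finally show "form_apply (form_pullback J (form_pullback J \<alpha>)) x = form_apply \<alpha> x"
      using x by simp
  qed
  then have inv: "vec_push J (vec_push J u) = u" for u :: "('a, 2) kvec"
    by (intro eqI) (simp add: push)
  let ?p = "(1/2) *\<^sub>R (u + vec_push J u)" and ?m = "(1/2) *\<^sub>R (u + (-1) *\<^sub>R vec_push J u)"
  show ?thesis
  proof (rule ex1I[of _ ?p])
    have "?p \<in> Lambda_plus J"
      by (simp add: Lambda_plus_def add scale inv add.commute)
    moreover have "?m \<in> Lambda_minus J"
      unfolding Lambda_minus_def mem_Collect_eq add scale inv
      by (simp add: algebra_simps)
    moreover have "u = ?p + ?m"
      by (simp add: algebra_simps flip: scaleR_left_distrib)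
    ultimately show "?p \<in> Lambda_plus J \<and> (\<exists>m\<in>Lambda_minus J. u = ?p + m)" by blast
  next
    fix p assume "p \<in> Lambda_plus J \<and> (\<exists>m\<in>Lambda_minus J. u = p + m)"
    then obtain m where "vec_push J p = p" "vec_push J m = - m" "u = p + m"
      by (auto simp: Lambda_plus_def Lambda_minus_def)
    then show "p = ?p"
      by (simp add: add algebra_simps flip: scaleR_left_distrib)
  qed
qed

definition positive_cone :: "('a::real_vector \<Rightarrow> 'a) \<Rightarrow> ('a, 2) kvec set" where
  "positive_cone J = convex hull (range (\<lambda>v. blade (vector [v, J v])))"

definition tamed_by ::
  "('a::real_vector \<Rightarrow> 'a \<Rightarrow> 'a) \<Rightarrow> ('a \<Rightarrow> 'a) \<Rightarrow> ('a, 2) kform \<Rightarrow> bool" where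
  "tamed_by br J \<phi> \<longleftrightarrow>
     closed_form br \<phi> \<and> (\<forall>v. v \<noteq> 0 \<longrightarrow> evaluate \<phi> (blade (vector [v, J v])) > 0)"

definition compatible_with ::
  "('a::real_vector \<Rightarrow> 'a \<Rightarrow> 'a) \<Rightarrow> ('a \<Rightarrow> 'a) \<Rightarrow> ('a, 2) kform \<Rightarrow> bool" where
  "compatible_with br J \<phi> \<longleftrightarrow> tamed_by br J \<phi> \<and> \<phi> \<in> Lambda_plus_forms J"

definition tamed :: "('a::real_vector \<Rightarrow> 'a \<Rightarrow> 'a) \<Rightarrow> ('a \<Rightarrow> 'a) \<Rightarrow> bool" where
  "tamed br J \<longleftrightarrow> (\<exists>\<phi>. tamed_by br J \<phi>)"

definition almost_kahler :: "('a::real_vector \<Rightarrow> 'a \<Rightarrow> 'a) \<Rightarrow> ('a \<Rightarrow> 'a) \<Rightarrow> bool" where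
  "almost_kahler br J \<longleftrightarrow> (\<exists>\<phi>. compatible_with br J \<phi>)"

end

theory Submission
  imports Defs
begin

text \<open>Choose a complex basis of the four-dimensional space. The space of \<open>J\<close>-invariant 2-vectors
  becomes the space of Hermitian matrices of size two, and the positive cone becomes the cone of
  positive semidefinite matrices. Write a 2-vector as \<open>u = p + m\<close> with \<open>p\<close> invariant and \<open>m\<close>
  anti-invariant. Relative to a volume form, \<open>u \<and> u\<close> is a positive multiple of \<open>det p + \<bar>m\<bar>\<^sup>2\<close>: the
  wedge square has Lorentz signature \<open>(1, 3)\<close> on invariant 2-vectors and is positive definite on
  anti-invariant ones (\<open>kwedge_square_0\<close>).

  A boundary \<open>u\<close> satisfies \<open>u \<and> u = 0\<close> by assumption. This gives the two implications that depend on
  dimension four. If \<open>u\<close> is invariant, its matrix has determinant zero, hence rank at most one, and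
  \<open>u\<close> or \<open>- u\<close> is a blade \<open>v \<and> J v\<close>; so a nonzero invariant boundary yields a nonzero boundary in
  the cone (\<open>null_Lambda_plus\<close>). If the invariant part of \<open>u\<close> lies in the cone, then \<open>det p \<ge> 0\<close>, which
  together with \<open>det p + \<bar>m\<bar>\<^sup>2 = 0\<close> forces \<open>m = 0\<close>, so that \<open>u\<close> itself is invariant
  (\<open>null_proj_plus\<close>).

  The remaining implications are duality. A form is closed exactly when it vanishes on boundaries
  (\<open>closed_form_iff_boundaries\<close>), and a taming form is positive on the cone away from zero. Conversely,
  if the projected boundaries meet the cone only in zero, some hyperplane contains them and misses
  a compact base of the cone; it is the kernel of an invariant form, and this form is compatible
  with \<open>J\<close> (\<open>compatible_form_exists\<close>).\<close>

section \<open>Evaluation of forms on multivectors\<close>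

lemma kform_eqI: "(\<And>x. form_apply \<phi> x = form_apply \<psi> x) \<Longrightarrow> \<phi> = \<psi>"
  by (simp add: fun_eq_iff flip: form_apply_inject)

lemma kvec_eqI: "(\<And>\<phi>. evaluate \<phi> u = evaluate \<phi> w) \<Longrightarrow> u = w"
  by (simp add: fun_eq_iff flip: vec_pair_inject)

lemma linear_evaluate: "linear (evaluate \<phi>)"
  by (auto intro!: linearI simp: plus_kvec.rep_eq scaleR_kvec.rep_eq)

lemma linear_evaluate_form: "linear (\<lambda>\<phi>. evaluate \<phi> u)"
proof -
  obtain S c where "finite S" and u: "\<And>\<alpha>. vec_pair u \<alpha> = (\<Sum>x\<in>S. c x * form_apply \<alpha> x)"
    using vec_pair_sum[of u] by metis
  show ?thesis
    by (rule linearI)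
      (simp_all add: u plus_kform.rep_eq scaleR_kform.rep_eq distrib_left sum.distrib
        sum_distrib_left mult.left_commute)
qed

lemmas evaluate_vec_simps =
  linear_add[OF linear_evaluate] linear_diff[OF linear_evaluate]
  linear_scale[OF linear_evaluate] linear_neg[OF linear_evaluate]
  linear_0[OF linear_evaluate]

lemmas evaluate_form_simps =
  linear_add[OF linear_evaluate_form] linear_diff[OF linear_evaluate_form]
  linear_scale[OF linear_evaluate_form] linear_neg[OF linear_evaluate_form]

lemma vec2_eta: "(x :: 'a::zero ^ 2) = vector [x $ 1, x $ 2]"
  by (simp add: vec_eq_iff forall_2)

definition wedge_form ::
  "('a::real_vector \<Rightarrow> real) \<Rightarrow> ('a \<Rightarrow> real) \<Rightarrow> ('a, 2) kform" (infix "\<curlywedge>" 75) where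
  "f \<curlywedge> g = Abs_kform (\<lambda>x. f (x $ 1) * g (x $ 2) - f (x $ 2) * g (x $ 1))"

lemma wedge_form_apply:
  assumes "linear f" "linear g"
  shows "form_apply (f \<curlywedge> g) x = f (x $ 1) * g (x $ 2) - f (x $ 2) * g (x $ 1)"
proof -
  note lin = linear_add[OF assms(1)] linear_add[OF assms(2)]
    linear_scale[OF assms(1)] linear_scale[OF assms(2)]
  have "multilin (\<lambda>x :: 'a ^ 2. f (x $ 1) * g (x $ 2) - f (x $ 2) * g (x $ 1))"
    unfolding multilin_def
  proof (intro allI)
    fix x :: "'a ^ 2" and i :: 2
    show "linear (\<lambda>v. f (vupd x i v $ 1) * g (vupd x i v $ 2) - f (vupd x i v $ 2) * g (vupd x i v $ 1))"
      using exhaust_2[of i]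
      by (elim disjE; intro linearI) (simp_all add: vupd_def lin algebra_simps)
  qed
  moreover have "alternating (\<lambda>x :: 'a ^ 2. f (x $ 1) * g (x $ 2) - f (x $ 2) * g (x $ 1))"
    by (auto simp: alternating_def forall_2)
  ultimately show ?thesis
    by (simp add: wedge_form_def Abs_kform_inverse)
qed

lemma evaluate_wedge_form_blade:
  assumes "linear f" "linear g"
  shows "evaluate (f \<curlywedge> g) (blade (vector [u, v])) = f u * g v - f v * g u"
  by (simp add: evaluate_blade wedge_form_apply assms)

section \<open>The wedge square of a 2-vector\<close>

text \<open>The Laplace expansion, along the first two arguments, of the determinant of the values of
  four functionals on four vectors. The arguments carry the index type \<open>2 + 2\<close>, in which the wedge
  product of two 2-vectors lives; in this expanded form, fixing two arguments visibly leaves a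
  combination of the six forms \<open>s \<curlywedge> t\<close>.\<close>

definition laplace_det ::
  "('a \<Rightarrow> real) \<Rightarrow> ('a \<Rightarrow> real) \<Rightarrow> ('a \<Rightarrow> real) \<Rightarrow> ('a \<Rightarrow> real) \<Rightarrow> 'a ^ (2 + 2) \<Rightarrow> real"
  where
  "laplace_det f g h k x =
     (let m = (\<lambda>s t i j. s (x $ i) * t (x $ j) - s (x $ j) * t (x $ i));
          a = Inl 1; b = Inl 2; c = Inr 1; d = Inr 2
      in m f g a b * m h k c d - m f h a b * m g k c d + m f k a b * m g h c d
         + m g h a b * m f k c d - m g k a b * m f h c d + m h k a b * m f g c d)"

definition volume_form ::
  "('a::real_vector \<Rightarrow> real) \<Rightarrow> ('a \<Rightarrow> real) \<Rightarrow> ('a \<Rightarrow> real) \<Rightarrow> ('a \<Rightarrow> real) \<Rightarrow> ('a, 2 + 2) kform"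
  where
  "volume_form f g h k = Abs_kform (laplace_det f g h k)"

lemma volume_form_apply:
  assumes "linear f" "linear g" "linear h" "linear k"
  shows "form_apply (volume_form f g h k) = laplace_det f g h k" (is "_ = ?F")
proof -
  note lin = assms[THEN linear_add] assms[THEN linear_scale]
  have index_cases: "i = Inl 1 \<or> i = Inl 2 \<or> i = Inr 1 \<or> i = Inr 2" for i :: "2 + 2"
    using exhaust_2 by (cases i) auto
  have "multilin ?F"
    unfolding multilin_def
  proof (intro allI)
    fix x :: "'a ^ (2 + 2)" and i :: "2 + 2"
    show "linear (\<lambda>v. ?F (vupd x i v))"
      using index_cases[of i]
      by (elim disjE; intro linearI) (simp_all add: vupd_def lin laplace_det_def Let_def algebra_simps)
  qed
  moreover have "alternating ?F"
    unfolding alternating_def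
  proof (intro allI impI)
    fix x :: "'a ^ (2 + 2)" and i j
    assume "i \<noteq> j" "x $ i = x $ j"
    then show "?F x = 0"
      using index_cases[of i] index_cases[of j]
      by (elim disjE) (simp_all add: laplace_det_def Let_def algebra_simps)
  qed
  ultimately show ?thesis
    by (simp add: volume_form_def Abs_kform_inverse)
qed

text \<open>The quadratic form \<open>u \<mapsto> u \<and> u\<close> in coordinates: for \<open>w = u\<close> the right hand side is twice the
  Pluecker (Klein) quadric. The wedge product pairs \<open>u\<close> with the 2-form obtained by contracting \<open>w\<close>
  into the volume form, so it suffices to contract one factor at a time.\<close>

lemma evaluate_volume_form:
  assumes "linear f" "linear g" "linear h" "linear k"
  shows "evaluate (volume_form f g h k) (kwedge u w) =
      evaluate (f \<curlywedge> g) u * evaluate (h \<curlywedge> k) w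
    - evaluate (f \<curlywedge> h) u * evaluate (g \<curlywedge> k) w
    + evaluate (f \<curlywedge> k) u * evaluate (g \<curlywedge> h) w
    + evaluate (g \<curlywedge> h) u * evaluate (f \<curlywedge> k) w
    - evaluate (g \<curlywedge> k) u * evaluate (f \<curlywedge> h) w
    + evaluate (h \<curlywedge> k) u * evaluate (f \<curlywedge> g) w"
proof -
  note apply_simps = wedge_form_apply assms plus_kform.rep_eq minus_kform.rep_eq scaleR_kform.rep_eq
  have slice: "slice (volume_form f g h k) x =
      form_apply (f \<curlywedge> g) x *\<^sub>R (h \<curlywedge> k) - form_apply (f \<curlywedge> h) x *\<^sub>R (g \<curlywedge> k)
    + form_apply (f \<curlywedge> k) x *\<^sub>R (g \<curlywedge> h) + form_apply (g \<curlywedge> h) x *\<^sub>R (f \<curlywedge> k)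
    - form_apply (g \<curlywedge> k) x *\<^sub>R (f \<curlywedge> h) + form_apply (h \<curlywedge> k) x *\<^sub>R (f \<curlywedge> g)" for x
    by (rule kform_eqI) (simp add: slice.rep_eq volume_form_apply laplace_det_def vjoin_def Let_def apply_simps)
  have "contract (volume_form f g h k) w =
      evaluate (h \<curlywedge> k) w *\<^sub>R (f \<curlywedge> g) - evaluate (g \<curlywedge> k) w *\<^sub>R (f \<curlywedge> h)
    + evaluate (g \<curlywedge> h) w *\<^sub>R (f \<curlywedge> k) + evaluate (f \<curlywedge> k) w *\<^sub>R (g \<curlywedge> h)
    - evaluate (f \<curlywedge> h) w *\<^sub>R (g \<curlywedge> k) + evaluate (f \<curlywedge> g) w *\<^sub>R (h \<curlywedge> k)"
    by (rule kform_eqI)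
      (simp add: contract.rep_eq slice evaluate_form_simps plus_kform.rep_eq minus_kform.rep_eq
        scaleR_kform.rep_eq mult.commute)
  then show ?thesis
    by (simp add: kwedge_pair evaluate_form_simps mult.commute)
qed

section \<open>Closed forms, boundaries and the positive cone\<close>

lemma subspace_boundaries: "subspace (boundaries br)"
proof (rule subspaceI)
  show "0 \<in> boundaries br"
    unfolding boundaries_def by (intro CollectI exI[of _ 0]) (simp add: evaluate_vec_simps)
next
  fix u w assume "u \<in> boundaries br" "w \<in> boundaries br"
  then obtain a b where "\<And>\<phi>. evaluate \<phi> u = evaluate (ce_d br \<phi>) a"
    "\<And>\<phi>. evaluate \<phi> w = evaluate (ce_d br \<phi>) b"
    by (auto simp: boundaries_def)
  then show "u + w \<in> boundaries br"
    unfolding boundaries_def by (intro CollectI exI[of _ "a + b"]) (simp add: evaluate_vec_simps)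
next
  fix r u assume "u \<in> boundaries br"
  then obtain a where "\<And>\<phi>. evaluate \<phi> u = evaluate (ce_d br \<phi>) a"
    by (auto simp: boundaries_def)
  then show "r *\<^sub>R u \<in> boundaries br"
    unfolding boundaries_def by (intro CollectI exI[of _ "r *\<^sub>R a"]) (simp add: evaluate_vec_simps)
qed

text \<open>The forms \<open>d \<phi>\<close> and boundaries are dual: the value of \<open>d \<phi>\<close> on three vectors is the value
  of \<open>\<phi>\<close> on a 2-vector that is independent of \<open>\<phi>\<close>, and this 2-vector is a boundary.\<close>

lemma closed_form_iff_boundaries:
  assumes "lie_algebra br"
  shows "closed_form br \<phi> \<longleftrightarrow> (\<forall>u\<in>boundaries br. evaluate \<phi> u = 0)"
proof
  assume "closed_form br \<phi>"
  then have zero: "form_apply (ce_d br \<phi>) x = 0" for x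
    by (simp add: closed_form_def zero_kform.rep_eq)
  have "evaluate (ce_d br \<phi>) w = 0" for w
  proof -
    obtain S c where "finite S" "\<And>\<alpha>. vec_pair w \<alpha> = (\<Sum>x\<in>S. c x * form_apply \<alpha> x)"
      using vec_pair_sum[of w] by blast
    then show ?thesis by (simp add: zero)
  qed
  then show "\<forall>u\<in>boundaries br. evaluate \<phi> u = 0"
    by (auto simp: boundaries_def)
next
  interpret lie_algebra br by fact
  assume vanish: "\<forall>u\<in>boundaries br. evaluate \<phi> u = 0"
  show "closed_form br \<phi>"
    unfolding closed_form_def
  proof (rule kform_eqI)
    fix x :: "'a ^ 3"
    let ?u = "- blade (vector [br (x $ 1) (x $ 2), x $ 3])
       + blade (vector [br (x $ 1) (x $ 3), x $ 2])
       - blade (vector [br (x $ 2) (x $ 3), x $ 1])"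
    have u: "evaluate \<psi> ?u = evaluate (ce_d br \<psi>) (blade x)" for \<psi>
      by (simp add: evaluate_vec_simps evaluate_blade ce_d_apply)
    then have "?u \<in> boundaries br"
      unfolding boundaries_def by blast
    then show "form_apply (ce_d br \<phi>) x = form_apply 0 x"
      using vanish u[of \<phi>] by (simp add: evaluate_blade zero_kform.rep_eq)
  qed
qed

lemma blade_zero: "blade (vector [0, v] :: 'a::real_vector ^ 2) = 0"
  by (rule kvec_eqI) (simp add: evaluate_blade evaluate_vec_simps linear_0[OF form2_linear(1)])

lemma tamed_form_pos_on_cone:
  assumes "\<And>v. v \<noteq> 0 \<Longrightarrow> evaluate \<phi> (blade (vector [v, J v])) > 0"
    and "w \<in> positive_cone J" "w \<noteq> 0"
  shows "evaluate \<phi> w > 0"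
proof -
  \<comment> \<open>The half-space of positivity is not enough: \<open>v = 0\<close> puts zero into the cone.\<close>
  have "convex {w. w = 0 \<or> evaluate \<phi> w > 0}" (is "convex ?C")
  proof (rule convexI)
    fix u w and s t :: real
    assume *: "u \<in> ?C" "w \<in> ?C" "0 \<le> s" "0 \<le> t" "s + t = 1"
    then have "evaluate \<phi> u \<ge> 0" "evaluate \<phi> w \<ge> 0"
      by (auto simp: evaluate_vec_simps)
    then have nonneg: "s * evaluate \<phi> u \<ge> 0" "t * evaluate \<phi> w \<ge> 0"
      using * by auto
    have "s *\<^sub>R u = 0 \<or> s * evaluate \<phi> u > 0" "t *\<^sub>R w = 0 \<or> t * evaluate \<phi> w > 0"
      using * by (auto simp: less_le)
    then show "s *\<^sub>R u + t *\<^sub>R w \<in> ?C"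
      using nonneg by (auto simp: evaluate_vec_simps)
  qed
  moreover have "range (\<lambda>v. blade (vector [v, J v])) \<subseteq> ?C"
    using assms(1) blade_zero by (metis (mono_tags, lifting) CollectI image_subsetI)
  ultimately have "positive_cone J \<subseteq> ?C"
    unfolding positive_cone_def by (intro hull_minimal)
  then show ?thesis
    using assms by auto
qed

section \<open>Positive semidefinite Hermitian matrices of size two\<close>

text \<open>A tuple \<open>(p, q, r, s)\<close> stands for the Hermitian matrix with diagonal \<open>p\<close>, \<open>q\<close> and off-diagonal
  entry \<open>s + i r\<close>, whose determinant is \<open>p q - r\<^sup>2 - s\<^sup>2\<close>. This is the matrix with entries
  \<open>z\<^sub>j cnj z\<^sub>k\<close> for \<open>z\<^sub>1 = a + i b\<close> and \<open>z\<^sub>2 = c + i d\<close>.\<close>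

definition rank_one :: "real \<times> real \<times> real \<times> real \<Rightarrow> real \<times> real \<times> real \<times> real" where
  "rank_one = (\<lambda>(a, b, c, d). (a\<^sup>2 + b\<^sup>2, c\<^sup>2 + d\<^sup>2, b * c - a * d, a * c + b * d))"

text \<open>Sums of rank one matrices are positive semidefinite, so their determinant is nonnegative.
  Semidefiniteness is expressed as membership in an intersection of half-spaces, one for each test
  vector \<open>(a, c + i b)\<close>; it then passes to convex combinations for free. Multiplying a test
  vector by a phase does not change its value, hence \<open>a\<close> may be real.\<close>

lemma hull_rank_one_det_nonneg:
  assumes "(p, q, r, s) \<in> convex hull (range rank_one)"
  shows "r\<^sup>2 + s\<^sup>2 \<le> p * q"
proof -
  let ?C = "\<Inter>(a, b, c). {z. (a\<^sup>2, b\<^sup>2 + c\<^sup>2, 2 * a * b, 2 * a * c) \<bullet> z \<ge> 0}"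
  have "convex ?C"
    by (auto intro!: convex_INT convex_halfspace_ge)
  moreover have "range rank_one \<subseteq> ?C"
  proof clarsimp
    fix a b c x y z t :: real
    \<comment> \<open>The value of the functional is \<open>\<bar>a z\<^sub>1 + (c + i b) z\<^sub>2\<bar>\<^sup>2\<close> with \<open>z\<^sub>1 = x + i y\<close> and
      \<open>z\<^sub>2 = z + i t\<close>.\<close>
    have "(a\<^sup>2, b\<^sup>2 + c\<^sup>2, 2 * a * b, 2 * a * c) \<bullet> rank_one (x, y, z, t)
        = (a * x - b * t + c * z)\<^sup>2 + (a * y + b * z + c * t)\<^sup>2"
      by (simp add: rank_one_def power2_eq_square algebra_simps)
    then show "0 \<le> (a\<^sup>2, b\<^sup>2 + c\<^sup>2, 2 * a * b, 2 * a * c) \<bullet> rank_one (x, y, z, t)"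
      by simp
  qed
  ultimately have "(p, q, r, s) \<in> ?C"
    using assms hull_minimal[of "range rank_one" ?C convex] by blast
  then have psd: "0 \<le> a\<^sup>2 * p + (b\<^sup>2 + c\<^sup>2) * q + 2 * a * b * r + 2 * a * c * s" for a b c
    by (simp add: algebra_simps)
  \<comment> \<open>The test vector \<open>(q, - s - i r)\<close> is the first row of the adjugate matrix, so that the
    quadratic form takes the value \<open>q\<close> times the determinant there; for \<open>q = 0\<close> the test vectors
    \<open>(a, - s - i r)\<close> force the off-diagonal entry to vanish.\<close>
  have "q \<ge> 0" using psd[of 0 1 0] by simp
  show ?thesis
  proof (cases "q = 0")
    case True
    have "0 \<le> a\<^sup>2 * p - 2 * a * (r\<^sup>2 + s\<^sup>2)" for a
      using psd[of a "- r" "- s"] True by (simp add: power2_eq_square algebra_simps)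
    moreover define D where "D = r\<^sup>2 + s\<^sup>2"
    ultimately have D: "0 \<le> a\<^sup>2 * p - 2 * a * D" for a by simp
    have "p \<ge> 0" using psd[of 1 0 0] by simp
    have "D \<le> 0"
    proof (cases "p = 0")
      case True
      then show ?thesis using D[of 1] by simp
    next
      case False
      then have "0 \<le> - (D\<^sup>2 / p)"
        using D[of "D / p"] by (simp add: power2_eq_square)
      then show ?thesis
        using False \<open>p \<ge> 0\<close> by (simp add: divide_le_0_iff)
    qed
    then have "r\<^sup>2 + s\<^sup>2 \<le> 0" by (simp add: D_def)
    then show ?thesis using True by simp
  next
    case False
    have "0 \<le> q * (p * q - (r\<^sup>2 + s\<^sup>2))"
      using psd[of q "- r" "- s"] by (simp add: power2_eq_square algebra_simps)
    then show ?thesis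
      using False \<open>q \<ge> 0\<close> by (simp add: zero_le_mult_iff)
  qed
qed

text \<open>A Hermitian matrix of size two with determinant zero has rank at most one, so it is
  semidefinite of one sign.\<close>

lemma null_hermitian:
  assumes "p * q = r\<^sup>2 + s\<^sup>2"
  shows "\<exists>z. (p, q, r, s) = rank_one z \<or> - (p, q, r, s) = rank_one z"
proof -
  have *: "\<exists>z. (p, q, r, s) = rank_one z" if "p * q = r\<^sup>2 + s\<^sup>2" "p > 0" for p q r s :: real
  proof -
    have "q = (r\<^sup>2 + s\<^sup>2) / p" using that by (simp add: field_simps)
    then have "(p, q, r, s) = rank_one (sqrt p, 0, s / sqrt p, - r / sqrt p)"
      using that(2) by (simp add: rank_one_def power_divide add_divide_distrib)
    then show ?thesis ..
  qed
  consider "p > 0" | "p < 0" | "p = 0" by linarith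
  then show ?thesis
  proof cases
    case 1
    then show ?thesis using *[OF assms] by blast
  next
    case 2
    then show ?thesis using *[of "- p" "- q" "- r" "- s"] assms by auto
  next
    case 3
    then have "r = 0" "s = 0" using assms by (simp_all add: sum_power2_eq_zero_iff)
    moreover have "q = (sqrt \<bar>q\<bar>)\<^sup>2 \<or> - q = (sqrt \<bar>q\<bar>)\<^sup>2" by auto
    ultimately show ?thesis
      using 3 by (intro exI[of _ "(0, 0, sqrt \<bar>q\<bar>, 0)"]) (simp add: rank_one_def)
  qed
qed

section \<open>Coordinates adapted to an almost complex structure\<close>

text \<open>A complex basis \<open>e\<close>, \<open>f\<close> of the space with the real and imaginary parts of the complex
  coordinates \<open>z\<^sub>k = x\<^sub>k + i y\<^sub>k\<close>.\<close>

locale complex_frame =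
  fixes J :: "'a::real_vector \<Rightarrow> 'a" and e f :: 'a and x1 y1 x2 y2 :: "'a \<Rightarrow> real"
  assumes J: "almost_complex J"
    and linear_coords: "linear x1" "linear y1" "linear x2" "linear y2"
    and expand: "v = x1 v *\<^sub>R e + y1 v *\<^sub>R J e + x2 v *\<^sub>R f + y2 v *\<^sub>R J f"
    and coords:
      "x1 (a *\<^sub>R e + b *\<^sub>R J e + c *\<^sub>R f + d *\<^sub>R J f) = a"
      "y1 (a *\<^sub>R e + b *\<^sub>R J e + c *\<^sub>R f + d *\<^sub>R J f) = b"
      "x2 (a *\<^sub>R e + b *\<^sub>R J e + c *\<^sub>R f + d *\<^sub>R J f) = c"
      "y2 (a *\<^sub>R e + b *\<^sub>R J e + c *\<^sub>R f + d *\<^sub>R J f) = d"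

text \<open>Since \<open>J\<close> has no real eigenvalue, neither on the space nor modulo an invariant plane, any
  nonzero \<open>e\<close> and any \<open>f\<close> outside the plane of \<open>e\<close> and \<open>J e\<close> will do.\<close>

lemma complex_frame_exists:
  fixes J :: "'a::real_vector \<Rightarrow> 'a"
  assumes "dim (UNIV :: 'a set) = 4" "almost_complex J"
  obtains e f x1 y1 x2 y2 where "complex_frame J e f x1 y1 x2 y2"
proof -
  have lin: "linear J" and JJ: "J (J v) = - v" for v
    using assms(2) by (auto simp: almost_complex_def)
  obtain b :: "'a set" where b: "independent b" "span b = UNIV" "card b = 4"
    using basis_exists[of "UNIV :: 'a set"] assms(1) by (metis top.extremum_uniqueI)
  have card_le: "card s \<le> 4" if "independent s" for s :: "'a set"
    using independent_span_bound[of b s] b that by (auto simp: card_ge_0_finite)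
  have proper: "\<exists>v. v \<notin> span s" if "finite s" "card s < 4" for s :: "'a set"
  proof (rule ccontr)
    assume "\<not> ?thesis"
    then have "card b \<le> card s"
      using independent_span_bound[of s b] b(1) that(1) by auto
    then show False using b(3) that(2) by simp
  qed
  obtain e :: 'a where e: "e \<noteq> 0"
    using proper[of "{}"] by auto
  have Je: "J e \<notin> span {e}"
  proof
    assume "J e \<in> span {e}"
    then obtain t where t: "J e = t *\<^sub>R e" by (auto simp: span_singleton)
    then have "- e = (t * t) *\<^sub>R e"
      using JJ[of e] by (metis linear_scale[OF lin] scaleR_scaleR)
    then have "(t * t + 1) *\<^sub>R e = 0"
      by (simp add: scaleR_left_distrib eq_neg_iff_add_eq_0[symmetric])
    then show False using e
      by (simp add: sum_squares_eq_zero_iff add_nonneg_eq_0_iff)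
  qed
  let ?P = "span {J e, e}"
  have P_invariant: "J v \<in> ?P" if "v \<in> ?P" for v
    using that
  proof (induction rule: span_induct_alt)
    case base
    show ?case by (simp add: linear_0[OF lin] span_zero)
  next
    case (step c x y)
    have "J x \<in> ?P"
      using step(1) span_neg[OF span_base, of e "{J e, e}"] span_base[of "J e" "{J e, e}"]
      by (auto simp: JJ)
    then show ?case
      using step by (simp add: linear_add[OF lin] linear_scale[OF lin] span_add span_scale)
  qed
  obtain f where f: "f \<notin> ?P"
    using proper[of "{J e, e}"] card_insert_le_m1[of 2 "{e}" "J e"] by auto
  have Jf: "J f \<notin> span {f, J e, e}"
  proof
    assume "J f \<in> span {f, J e, e}"
    then obtain t where t: "J f - t *\<^sub>R f \<in> ?P"
      by (auto simp: span_insert[of f])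
    \<comment> \<open>Modulo \<open>?P\<close> the vector \<open>f\<close> is an eigenvector with eigenvalue \<open>t\<close>; applying \<open>J\<close> again gives
      \<open>t\<^sup>2 = - 1\<close>.\<close>
    have "J (J f - t *\<^sub>R f) + t *\<^sub>R (J f - t *\<^sub>R f) \<in> ?P"
      by (intro span_add span_scale P_invariant t)
    also have "J (J f - t *\<^sub>R f) + t *\<^sub>R (J f - t *\<^sub>R f) = - ((t * t + 1) *\<^sub>R f)"
      by (simp add: linear_diff[OF lin] linear_scale[OF lin] JJ algebra_simps)
    finally have "inverse (t * t + 1) *\<^sub>R ((t * t + 1) *\<^sub>R f) \<in> ?P"
      by (metis span_neg span_scale minus_minus)
    moreover have "inverse (t * t + 1) * (t * t + 1) = 1"
      by (simp add: add_nonneg_eq_0_iff)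
    ultimately show False using f by (simp only: scaleR_scaleR) simp
  qed
  define B where "B = {J f, f, J e, e}"
  have B: "independent B"
    unfolding B_def using e Je f Jf
    by (intro independent_insertI independent_empty) simp_all
  have distinct: "e \<noteq> J e" "e \<noteq> f" "e \<noteq> J f" "J e \<noteq> f" "J e \<noteq> J f" "f \<noteq> J f"
    using Je f Jf by (auto dest: span_base simp: span_base)
  \<comment> \<open>A fifth independent vector would exceed the dimension.\<close>
  have span_B: "v \<in> span B" for v
  proof (rule ccontr)
    assume v: "v \<notin> span B"
    then have "independent (insert v B)"
      using B by (rule independent_insertI)
    moreover have "v \<notin> B" using v by (metis span_base)
    ultimately show False
      using card_le[of "insert v B"] distinct by (simp add: B_def)
  qed
  let ?c = "representation B"
  have add: "?c (v + w) b = ?c v b + ?c w b" for v w b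
    using representation_add[OF B span_B span_B] by simp
  have scale: "?c (r *\<^sub>R v) b = r * ?c v b" for r v b
    using representation_scale[OF B span_B] by simp
  have basis: "?c u b = (if b = u then 1 else 0)" if "u \<in> B" for u b
    using representation_basis[OF B that] by simp
  have in_B: "e \<in> B" "J e \<in> B" "f \<in> B" "J f \<in> B"
    by (simp_all add: B_def)
  have linear_c: "linear (\<lambda>v. ?c v b)" for b
    by (auto intro!: linearI simp: add scale)
  have expand: "v = ?c v e *\<^sub>R e + ?c v (J e) *\<^sub>R J e + ?c v f *\<^sub>R f + ?c v (J f) *\<^sub>R J f" for v
  proof -
    have "v = (\<Sum>u\<in>B. ?c v u *\<^sub>R u)"
      using sum_representation_eq[OF B span_B _ order_refl] by (simp add: B_def)
    also have "\<dots> = ?c v e *\<^sub>R e + ?c v (J e) *\<^sub>R J e + ?c v f *\<^sub>R f + ?c v (J f) *\<^sub>R J f"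
      using distinct distinct[THEN not_sym] by (simp add: B_def)
    finally show ?thesis .
  qed
  have "complex_frame J e f (\<lambda>v. ?c v e) (\<lambda>v. ?c v (J e)) (\<lambda>v. ?c v f) (\<lambda>v. ?c v (J f))"
    by (intro complex_frame.intro assms(2) linear_c expand)
      (use distinct distinct[THEN not_sym] in \<open>simp_all add: add scale basis in_B\<close>)
  then show thesis by (rule that)
qed

context complex_frame
begin

lemma linear_J: "linear J" and J_J: "J (J v) = - v"
  using J by (auto simp: almost_complex_def)

lemma coords_J: "x1 (J v) = - y1 v" "y1 (J v) = x1 v" "x2 (J v) = - y2 v" "y2 (J v) = x2 v"
proof -
  have "J v = J (x1 v *\<^sub>R e + y1 v *\<^sub>R J e + x2 v *\<^sub>R f + y2 v *\<^sub>R J f)"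
    by (rule arg_cong[OF expand])
  also have "\<dots> = (- y1 v) *\<^sub>R e + x1 v *\<^sub>R J e + (- y2 v) *\<^sub>R f + x2 v *\<^sub>R J f"
    by (simp add: linear_add[OF linear_J] linear_scale[OF linear_J] J_J)
  finally have Jv: "J v = \<dots>" .
  show "x1 (J v) = - y1 v" "y1 (J v) = x1 v" "x2 (J v) = - y2 v" "y2 (J v) = x2 v"
    by (simp_all only: Jv coords)
qed

lemma pullback_coords:
  "form_pullback J (x1 \<curlywedge> y1) = x1 \<curlywedge> y1"
  "form_pullback J (x2 \<curlywedge> y2) = x2 \<curlywedge> y2"
  "form_pullback J (x1 \<curlywedge> x2) = y1 \<curlywedge> y2"
  "form_pullback J (y1 \<curlywedge> y2) = x1 \<curlywedge> x2"
  "form_pullback J (x1 \<curlywedge> y2) = - (y1 \<curlywedge> x2)"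
  "form_pullback J (y1 \<curlywedge> x2) = - (x1 \<curlywedge> y2)"
  by (rule kform_eqI,
      simp add: form_pullback_apply linear_J wedge_form_apply linear_coords vmap_def coords_J
        uminus_kform.rep_eq)+

lemma form_expand:
  "\<phi> = form_apply \<phi> (vector [e, J e]) *\<^sub>R (x1 \<curlywedge> y1)
     + form_apply \<phi> (vector [e, f]) *\<^sub>R (x1 \<curlywedge> x2)
     + form_apply \<phi> (vector [e, J f]) *\<^sub>R (x1 \<curlywedge> y2)
     + form_apply \<phi> (vector [J e, f]) *\<^sub>R (y1 \<curlywedge> x2)
     + form_apply \<phi> (vector [J e, J f]) *\<^sub>R (y1 \<curlywedge> y2)
     + form_apply \<phi> (vector [f, J f]) *\<^sub>R (x2 \<curlywedge> y2)" (is "_ = ?R")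
proof (rule kform_eqI)
  fix x :: "'a ^ 2"
  let ?E = "\<lambda>v. x1 v *\<^sub>R e + y1 v *\<^sub>R J e + x2 v *\<^sub>R f + y2 v *\<^sub>R J f"
  note lin = form2_linear[of \<phi>, THEN linear_add] form2_linear[of \<phi>, THEN linear_scale]
  have "form_apply \<phi> x = form_apply \<phi> (vector [x $ 1, x $ 2])"
    by (simp flip: vec2_eta)
  also have "\<dots> = form_apply \<phi> (vector [?E (x $ 1), ?E (x $ 2)])"
    by (simp flip: expand)
  also have "\<dots> = form_apply ?R x"
    using form2_swap[of \<phi> "J e" e] form2_swap[of \<phi> f e]
      form2_swap[of \<phi> "J f" e] form2_swap[of \<phi> f "J e"] form2_swap[of \<phi> "J f" "J e"]
      form2_swap[of \<phi> "J f" f]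
    unfolding lin form2_self
    by (simp add: plus_kform.rep_eq scaleR_kform.rep_eq wedge_form_apply linear_coords algebra_simps
        minus_kform.rep_eq uminus_kform.rep_eq)
  finally show "form_apply \<phi> x = form_apply ?R x" .
qed

text \<open>The six products of coordinate functions span the 2-forms, and 2-forms separate 2-vectors.\<close>

lemma kvec_eq_0_iff:
  "u = 0 \<longleftrightarrow> evaluate (x1 \<curlywedge> y1) u = 0 \<and> evaluate (x1 \<curlywedge> x2) u = 0 \<and> evaluate (x1 \<curlywedge> y2) u = 0
     \<and> evaluate (y1 \<curlywedge> x2) u = 0 \<and> evaluate (y1 \<curlywedge> y2) u = 0 \<and> evaluate (x2 \<curlywedge> y2) u = 0"
  (is "_ \<longleftrightarrow> ?R")
proof
  assume R: ?R
  show "u = 0"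
  proof (rule kvec_eqI)
    fix \<phi>
    show "evaluate \<phi> u = evaluate \<phi> 0"
      by (subst (1) form_expand) (simp add: R evaluate_form_simps evaluate_vec_simps)
  qed
qed (simp add: evaluate_vec_simps)

section \<open>Invariant 2-vectors as Hermitian matrices\<close>

text \<open>The Hermitian matrix of the invariant part of \<open>u\<close>: averaging \<open>u\<close> with its image under \<open>J\<close>
  fixes the two coordinates on complex lines and averages the others in pairs.\<close>

definition hermitian :: "('a, 2) kvec \<Rightarrow> real \<times> real \<times> real \<times> real" where
  "hermitian u = (evaluate (x1 \<curlywedge> y1) u, evaluate (x2 \<curlywedge> y2) u,
     (evaluate (x1 \<curlywedge> x2) u + evaluate (y1 \<curlywedge> y2) u) / 2,
     (evaluate (x1 \<curlywedge> y2) u - evaluate (y1 \<curlywedge> x2) u) / 2)"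

lemma linear_hermitian: "linear hermitian"
  by (rule linearI) (simp_all add: hermitian_def evaluate_vec_simps field_simps)

lemma Lambda_plus_coords:
  assumes "u \<in> Lambda_plus J"
  shows "evaluate (y1 \<curlywedge> y2) u = evaluate (x1 \<curlywedge> x2) u"
    and "evaluate (y1 \<curlywedge> x2) u = - evaluate (x1 \<curlywedge> y2) u"
proof -
  have "evaluate \<phi> u = evaluate (form_pullback J \<phi>) u" for \<phi>
    using assms vec_push_pair[OF linear_J, of u \<phi>] by (simp add: Lambda_plus_def)
  from this[of "x1 \<curlywedge> x2"] this[of "y1 \<curlywedge> x2"]
  show "evaluate (y1 \<curlywedge> y2) u = evaluate (x1 \<curlywedge> x2) u"
    "evaluate (y1 \<curlywedge> x2) u = - evaluate (x1 \<curlywedge> y2) u"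
    by (simp_all add: pullback_coords evaluate_form_simps)
qed

lemma hermitian_Lambda_minus:
  assumes "m \<in> Lambda_minus J"
  shows "hermitian m = 0"
proof -
  have "- evaluate \<phi> m = evaluate (form_pullback J \<phi>) m" for \<phi>
    using assms vec_push_pair[OF linear_J, of m \<phi>] by (simp add: Lambda_minus_def evaluate_vec_simps)
  from this[of "x1 \<curlywedge> y1"] this[of "x2 \<curlywedge> y2"] this[of "x1 \<curlywedge> x2"] this[of "x1 \<curlywedge> y2"]
  show ?thesis
    by (simp add: hermitian_def pullback_coords evaluate_form_simps zero_prod_def)
qed

lemma hermitian_inj_on_Lambda_plus: "inj_on hermitian (Lambda_plus J)"
proof (rule inj_onI)
  fix u w assume *: "u \<in> Lambda_plus J" "w \<in> Lambda_plus J" "hermitian u = hermitian w"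
  note Lambda_plus_coords[OF *(1)] Lambda_plus_coords[OF *(2)]
  then have "u - w = 0"
    using *(3) unfolding kvec_eq_0_iff by (simp add: hermitian_def evaluate_vec_simps)
  then show "u = w" by simp
qed

lemma blade_J_Lambda_plus: "blade (vector [v, J v]) \<in> Lambda_plus J"
proof -
  have "vmap J (vector [v, J v] :: 'a ^ 2) = vector [J v, - v]"
    by (simp add: vmap_def vec_eq_iff forall_2 J_J)
  then have "vec_push J (blade (vector [v, J v])) = blade (vector [J v, - v] :: 'a ^ 2)"
    by (simp add: vec_push_blade linear_J)
  also have "\<dots> = blade (vector [v, J v])"
    by (rule kvec_eqI)
      (simp add: evaluate_blade linear_neg[OF form2_linear(2)] form2_swap[of _ v "J v"])
  finally show ?thesis by (simp add: Lambda_plus_def)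
qed

lemma positive_cone_Lambda_plus: "positive_cone J \<subseteq> Lambda_plus J"
proof -
  have "subspace (Lambda_plus J)"
    by (rule subspaceI)
      (auto simp: Lambda_plus_def vec_push_pair[OF linear_J] evaluate_vec_simps
        fun_eq_iff simp flip: vec_pair_inject)
  then show ?thesis
    unfolding positive_cone_def
    by (intro hull_minimal) (auto simp: blade_J_Lambda_plus subspace_imp_convex)
qed

text \<open>The positive cone consists of the positive semidefinite matrices: \<open>v \<and> J v\<close> has the rank one matrix
  \<open>z\<^sub>j cnj z\<^sub>k\<close> of the complex coordinates of \<open>v\<close>.\<close>

lemma hermitian_blade_J:
  "hermitian (blade (vector [v, J v])) = rank_one (x1 v, y1 v, x2 v, y2 v)"
  by (simp add: hermitian_def rank_one_def evaluate_wedge_form_blade linear_coords coords_J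
      power2_eq_square field_simps)

lemma rank_one_hermitian: "rank_one z \<in> range (\<lambda>v. hermitian (blade (vector [v, J v])))"
proof -
  obtain a b c d where z: "z = (a, b, c, d)" by (cases z) auto
  show ?thesis
    by (rule range_eqI[of _ _ "a *\<^sub>R e + b *\<^sub>R J e + c *\<^sub>R f + d *\<^sub>R J f"])
      (simp only: z hermitian_blade_J coords)
qed

lemma hermitian_positive_cone: "hermitian ` positive_cone J = convex hull (range rank_one)"
proof -
  have "range (\<lambda>v. hermitian (blade (vector [v, J v]))) = range rank_one"
    using rank_one_hermitian by (auto simp: hermitian_blade_J)
  then show ?thesis
    by (simp add: positive_cone_def convex_hull_linear_image[OF linear_hermitian] image_image)
qed

text \<open>The decomposition of the wedge square: up to the factor 2 it is the determinant of the Hermitian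
  matrix of \<open>u\<close> plus the squared norm of the anti-invariant part, whose two coordinates are the
  squared expressions.\<close>

lemma kwedge_square_0:
  assumes "kwedge u u = 0" "hermitian u = (p, q, r, s)"
  shows "r\<^sup>2 + s\<^sup>2 = p * q
    + ((evaluate (x1 \<curlywedge> x2) u - evaluate (y1 \<curlywedge> y2) u) / 2)\<^sup>2
    + ((evaluate (x1 \<curlywedge> y2) u + evaluate (y1 \<curlywedge> x2) u) / 2)\<^sup>2"
proof -
  have volume: "evaluate (volume_form x1 y1 x2 y2) (kwedge u u) = 0"
    using assms(1) by (simp add: evaluate_vec_simps)
  have coords: "p = evaluate (x1 \<curlywedge> y1) u" "q = evaluate (x2 \<curlywedge> y2) u"
    "r = (evaluate (x1 \<curlywedge> x2) u + evaluate (y1 \<curlywedge> y2) u) / 2"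
    "s = (evaluate (x1 \<curlywedge> y2) u - evaluate (y1 \<curlywedge> x2) u) / 2"
    using assms(2) by (auto simp: hermitian_def)
  show ?thesis
    using volume unfolding evaluate_volume_form[OF linear_coords] coords
    by (simp add: power2_eq_square field_simps)
qed

text \<open>Every linear functional on Hermitian matrices comes from an invariant 2-form. Such a form sees
  only the invariant part of a 2-vector.\<close>

lemma evaluate_hermitian_form:
  assumes "\<phi> = a *\<^sub>R (x1 \<curlywedge> y1) + b *\<^sub>R (x2 \<curlywedge> y2)
    + (c / 2) *\<^sub>R (x1 \<curlywedge> x2 + y1 \<curlywedge> y2) + (d / 2) *\<^sub>R (x1 \<curlywedge> y2 - y1 \<curlywedge> x2)"
  shows "evaluate \<phi> u = (a, b, c, d) \<bullet> hermitian u" and "\<phi> \<in> Lambda_plus_forms J"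
proof -
  show "evaluate \<phi> u = (a, b, c, d) \<bullet> hermitian u"
    by (simp add: assms hermitian_def evaluate_form_simps field_simps)
  have "form_pullback J \<phi> = \<phi>"
    unfolding assms
    by (rule kform_eqI)
      (simp add: form_pullback_apply linear_J plus_kform.rep_eq scaleR_kform.rep_eq
        minus_kform.rep_eq wedge_form_apply linear_coords vmap_def coords_J algebra_simps)
  then show "\<phi> \<in> Lambda_plus_forms J" by (simp add: Lambda_plus_forms_def)
qed

lemma zero_in_positive_cone: "0 \<in> positive_cone J"
proof -
  have "0 \<in> range (\<lambda>v. blade (vector [v, J v] :: 'a ^ 2))"
    by (rule range_eqI[of _ _ 0]) (simp add: blade_zero)
  then show ?thesis
    unfolding positive_cone_def by (rule hull_inc)
qed

lemma proj_plus_decomp: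
  obtains m where "m \<in> Lambda_minus J" "proj_plus J u \<in> Lambda_plus J" "u = proj_plus J u + m"
  using theI'[OF proj_plus_unique[OF J, of u]] by (auto simp flip: proj_plus_def)

lemma hermitian_proj_plus: "hermitian (proj_plus J u) = hermitian u"
proof -
  obtain m where "m \<in> Lambda_minus J" "u = proj_plus J u + m"
    using proj_plus_decomp by blast
  then show ?thesis
    using hermitian_Lambda_minus linear_add[OF linear_hermitian] by (metis add.right_neutral)
qed

lemma proj_plus_eqI:
  assumes "w \<in> Lambda_plus J" "hermitian w = hermitian u"
  shows "proj_plus J u = w"
proof -
  obtain m where "proj_plus J u \<in> Lambda_plus J"
    by (rule proj_plus_decomp)
  then show ?thesis
    using assms by (intro inj_onD[OF hermitian_inj_on_Lambda_plus]) (simp_all add: hermitian_proj_plus)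
qed

section \<open>Isotropic 2-vectors and compatible forms\<close>

text \<open>On invariant 2-vectors the wedge square is the determinant, so an isotropic invariant 2-vector
  has a matrix of rank at most one, up to sign that of some \<open>v \<and> J v\<close>.\<close>

lemma null_Lambda_plus:
  assumes "u \<in> Lambda_plus J" "kwedge u u = 0"
  shows "u \<in> positive_cone J \<or> - u \<in> positive_cone J"
proof -
  obtain p q r s where h: "hermitian u = (p, q, r, s)" by (cases "hermitian u") auto
  have "p * q = r\<^sup>2 + s\<^sup>2"
    using kwedge_square_0[OF assms(2) h] Lambda_plus_coords[OF assms(1)] by simp
  then obtain z where z: "hermitian u = rank_one z \<or> - hermitian u = rank_one z"
    using null_hermitian h by metis
  obtain v where v: "hermitian (blade (vector [v, J v])) = rank_one z"
    using rank_one_hermitian[of z] by auto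
  have cone: "blade (vector [v, J v]) \<in> positive_cone J"
    unfolding positive_cone_def by (intro hull_inc) auto
  have "- u \<in> Lambda_plus J"
    using assms(1) by (auto simp: Lambda_plus_def vec_push_pair[OF linear_J] evaluate_vec_simps
        intro!: kvec_eqI dest: arg_cong[of _ _ "evaluate _"])
  have "hermitian (- u) = - hermitian u" by (rule linear_neg[OF linear_hermitian])
  then have "u = blade (vector [v, J v]) \<or> - u = blade (vector [v, J v])"
    using z v inj_onD[OF hermitian_inj_on_Lambda_plus] assms(1) \<open>- u \<in> Lambda_plus J\<close>
      blade_J_Lambda_plus by metis
  then show ?thesis using cone by auto
qed

text \<open>The two summands of the wedge square, the determinant of the invariant part and the squared norm
  of the anti-invariant part, are both nonnegative here and add up to zero; hence the anti-invariant
  part vanishes.\<close>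

lemma null_proj_plus:
  assumes "kwedge u u = 0" "proj_plus J u \<in> positive_cone J"
  shows "u \<in> Lambda_plus J"
proof -
  let ?w = "proj_plus J u"
  obtain m where m: "m \<in> Lambda_minus J" "?w \<in> Lambda_plus J" "u = ?w + m"
    by (rule proj_plus_decomp)
  obtain p q r s where h: "hermitian u = (p, q, r, s)" by (cases "hermitian u") auto
  have "r\<^sup>2 + s\<^sup>2 \<le> p * q"
    using imageI[OF assms(2), of hermitian] hull_rank_one_det_nonneg h
    by (simp add: hermitian_proj_plus hermitian_positive_cone)
  then have "((evaluate (x1 \<curlywedge> x2) u - evaluate (y1 \<curlywedge> y2) u) / 2)\<^sup>2
    + ((evaluate (x1 \<curlywedge> y2) u + evaluate (y1 \<curlywedge> x2) u) / 2)\<^sup>2 \<le> 0"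
    using kwedge_square_0[OF assms(1) h] by linarith
  then have "evaluate (x1 \<curlywedge> x2) u = evaluate (y1 \<curlywedge> y2) u"
    "evaluate (x1 \<curlywedge> y2) u = - evaluate (y1 \<curlywedge> x2) u"
    by (simp_all add: sum_power2_le_zero_iff)
  moreover have "evaluate \<phi> u = evaluate \<phi> ?w + evaluate \<phi> m" for \<phi>
    using m(3) evaluate_vec_simps(1) by metis
  ultimately have "evaluate (x1 \<curlywedge> x2) m = evaluate (y1 \<curlywedge> y2) m"
    "evaluate (x1 \<curlywedge> y2) m = - evaluate (y1 \<curlywedge> x2) m"
    using Lambda_plus_coords[OF m(2)] by simp_all
  then have "m = 0"
    using hermitian_Lambda_minus[OF m(1)] by (simp add: kvec_eq_0_iff hermitian_def zero_prod_def)
  then show ?thesis using m by simp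
qed

text \<open>The cone is not compact, but the matrices \<open>v \<and> J v\<close> with coordinate vector \<open>v\<close> on the unit
  sphere have trace one, and their convex hull \<open>?K\<close> is compact and generates it. A hyperplane that
  strictly separates \<open>?K\<close> from the subspace of projected boundaries must contain that subspace, and
  its equation is the required form.\<close>

lemma compatible_form_exists:
  assumes "subspace B" "proj_plus J ` B \<inter> positive_cone J = {0}"
  obtains \<phi> where "\<phi> \<in> Lambda_plus_forms J" "\<And>u. u \<in> B \<Longrightarrow> evaluate \<phi> u = 0"
    "\<And>v. v \<noteq> 0 \<Longrightarrow> evaluate \<phi> (blade (vector [v, J v])) > 0"
proof -
  let ?K = "convex hull (rank_one ` sphere 0 1)" and ?S = "hermitian ` B"
  have S: "subspace ?S"
    using assms(1) linear_hermitian by (rule linear_subspace_image[rotated])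
  have "continuous_on (sphere 0 1) rank_one"
    unfolding rank_one_def case_prod_beta by (intro continuous_intros)
  then have compact: "compact ?K"
    by (intro compact_convex_hull compact_continuous_image compact_sphere)
  have trace: "?K \<subseteq> {z. (1, 1, 0, 0) \<bullet> z = 1}"
  proof (intro hull_minimal)
    show "rank_one ` sphere 0 1 \<subseteq> {z. (1, 1, 0, 0) \<bullet> z = 1}"
      by (auto simp: rank_one_def norm_Pair)
  qed (rule convex_hyperplane)
  have disjoint: "?S \<inter> ?K = {}"
  proof (rule ccontr)
    assume "?S \<inter> ?K \<noteq> {}"
    then obtain u where u: "u \<in> B" "hermitian u \<in> ?K" by auto
    have "?K \<subseteq> hermitian ` positive_cone J"
      unfolding hermitian_positive_cone by (intro hull_mono) auto
    then obtain w where w: "w \<in> positive_cone J" "hermitian w = hermitian u"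
      using u(2) by (auto simp: image_iff)
    have "proj_plus J u = w"
      using subsetD[OF positive_cone_Lambda_plus w(1)] w(2) by (rule proj_plus_eqI)
    then have "w = 0" using assms(2) u(1) w(1) by auto
    then have "hermitian u = 0" using w(2) linear_0[OF linear_hermitian] by simp
    then show False using trace u(2) by auto
  qed
  have "rank_one (1, 0, 0, 0) \<in> ?K"
    by (intro hull_inc imageI) (simp add: norm_Pair)
  then have "?K \<noteq> {}" by blast
  then obtain n \<beta> where n: "\<forall>z\<in>?S. n \<bullet> z < \<beta>" "\<forall>z\<in>?K. n \<bullet> z > \<beta>"
    using separating_hyperplane_closed_compact[OF subspace_imp_convex[OF S] closed_subspace[OF S]
      convex_convex_hull compact _ disjoint] by blast
  have "\<beta> > 0" using n(1) subspace_0[OF S] by fastforce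
  \<comment> \<open>A functional that is bounded above on a subspace vanishes there.\<close>
  have n0: "n \<bullet> z = 0" if "z \<in> ?S" for z
  proof (rule ccontr)
    assume "n \<bullet> z \<noteq> 0"
    moreover have "n \<bullet> ((\<beta> / (n \<bullet> z)) *\<^sub>R z) < \<beta>"
      using n(1) subspace_scale[OF S that] by blast
    ultimately show False by simp
  qed
  obtain a b c d where abcd: "n = (a, b, c, d)" by (cases n) auto
  define \<phi> where "\<phi> = a *\<^sub>R (x1 \<curlywedge> y1) + b *\<^sub>R (x2 \<curlywedge> y2)
    + (c / 2) *\<^sub>R (x1 \<curlywedge> x2 + y1 \<curlywedge> y2) + (d / 2) *\<^sub>R (x1 \<curlywedge> y2 - y1 \<curlywedge> x2)"
  note \<phi> = evaluate_hermitian_form[OF \<phi>_def, folded abcd]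
  show thesis
  proof (rule that)
    show "\<phi> \<in> Lambda_plus_forms J" by (rule \<phi>)
    show "evaluate \<phi> u = 0" if "u \<in> B" for u
      using n0 that by (simp add: \<phi>)
  next
    fix v :: 'a assume "v \<noteq> 0"
    let ?z = "(x1 v, y1 v, x2 v, y2 v)"
    have "v = 0" if "?z = 0"
      using that by (subst expand) (simp add: zero_prod_def)
    then have "?z \<noteq> 0" using \<open>v \<noteq> 0\<close> by blast
    then have "norm ?z > 0" by (rule zero_less_norm_iff[THEN iffD2])
    define t where "t = 1 / norm ?z"
    have "rank_one (t *\<^sub>R ?z) \<in> ?K"
      using \<open>norm ?z > 0\<close> unfolding t_def by (intro hull_inc imageI) (simp del: scaleR_Pair)
    then have "0 < n \<bullet> rank_one (t *\<^sub>R ?z)"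
      using n(2) \<open>\<beta> > 0\<close> less_trans by blast
    also have "rank_one (t *\<^sub>R ?z) = t\<^sup>2 *\<^sub>R rank_one ?z"
      by (simp add: rank_one_def power2_eq_square algebra_simps)
    finally have "0 < n \<bullet> rank_one ?z"
      by (simp add: zero_less_mult_iff)
    then show "evaluate \<phi> (blade (vector [v, J v])) > 0"
      by (simp only: \<phi> hermitian_blade_J)
  qed
qed

end

theorem theorem2p5:
  fixes br :: "'a::real_vector \<Rightarrow> 'a \<Rightarrow> 'a" and J :: "'a \<Rightarrow> 'a"
  assumes "lie_algebra br" and "dim (UNIV :: 'a set) = 4"
    and "\<forall>u\<in>boundaries br. \<forall>w\<in>boundaries br. kwedge u w = 0"
    and "almost_complex J"
  shows "(tamed br J \<longleftrightarrow> boundaries br \<inter> positive_cone J = {0})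
    \<and> (boundaries br \<inter> positive_cone J = {0} \<longleftrightarrow> boundaries br \<inter> Lambda_plus J = {0})
    \<and> (boundaries br \<inter> Lambda_plus J = {0} \<longleftrightarrow> proj_plus J ` boundaries br \<inter> positive_cone J = {0})
    \<and> (proj_plus J ` boundaries br \<inter> positive_cone J = {0} \<longleftrightarrow> almost_kahler br J)"
proof -
  obtain e f x1 y1 x2 y2 where "complex_frame J e f x1 y1 x2 y2"
    using complex_frame_exists assms(2,4) by blast
  then interpret complex_frame J e f x1 y1 x2 y2 .
  let ?B = "boundaries br" and ?P = "positive_cone J"
  have isotropic: "kwedge u u = 0" if "u \<in> ?B" for u
    using assms(3) that by blast
  have zero: "0 \<in> ?B" "0 \<in> ?P" "0 \<in> Lambda_plus J"
    using subspace_0[OF subspace_boundaries] zero_in_positive_cone positive_cone_Lambda_plus by auto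
  have "?B \<inter> ?P = {0}" if tamed: "tamed br J"
  proof -
    obtain \<phi> where \<phi>: "closed_form br \<phi>" "\<And>v. v \<noteq> 0 \<Longrightarrow> evaluate \<phi> (blade (vector [v, J v])) > 0"
      using tamed unfolding tamed_def tamed_by_def by blast
    have "u = 0" if "u \<in> ?B" "u \<in> ?P" for u
      using tamed_form_pos_on_cone[OF \<phi>(2) that(2)] \<phi>(1) that(1)
      by (auto simp: closed_form_iff_boundaries[OF assms(1)])
    then show ?thesis using zero by auto
  qed
  moreover have "?B \<inter> Lambda_plus J = {0}" if "?B \<inter> ?P = {0}"
  proof -
    have "u = 0" if "u \<in> ?B" "u \<in> Lambda_plus J" for u
      using null_Lambda_plus[OF that(2) isotropic[OF that(1)]] that(1)
        subspace_neg[OF subspace_boundaries that(1)] \<open>?B \<inter> ?P = {0}\<close>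
      by (metis IntI neg_equal_0_iff_equal singletonD)
    then show ?thesis using zero by auto
  qed
  moreover have "proj_plus J ` ?B \<inter> ?P = {0}" if "?B \<inter> Lambda_plus J = {0}"
  proof -
    have proj_0: "proj_plus J 0 = 0"
      using zero(3) by (rule proj_plus_eqI) simp
    have "proj_plus J u = 0" if "u \<in> ?B" "proj_plus J u \<in> ?P" for u
    proof -
      have "u \<in> ?B \<inter> Lambda_plus J"
        using null_proj_plus[OF isotropic[OF that(1)] that(2)] that(1) by (rule IntI[rotated])
      then have "u = 0" unfolding \<open>?B \<inter> Lambda_plus J = {0}\<close> by (rule singletonD)
      then show ?thesis by (simp only: proj_0)
    qed
    moreover have "0 \<in> proj_plus J ` ?B"
      using zero(1) proj_0 by (metis imageI)
    ultimately show ?thesis using zero(2) by auto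
  qed
  moreover have "almost_kahler br J" if kernel: "proj_plus J ` ?B \<inter> ?P = {0}"
  proof -
    obtain \<phi> where "\<phi> \<in> Lambda_plus_forms J" "\<And>u. u \<in> ?B \<Longrightarrow> evaluate \<phi> u = 0"
      "\<And>v. v \<noteq> 0 \<Longrightarrow> evaluate \<phi> (blade (vector [v, J v])) > 0"
      using compatible_form_exists[OF subspace_boundaries kernel] by blast
    then show ?thesis
      by (auto simp: almost_kahler_def compatible_with_def tamed_by_def
          closed_form_iff_boundaries[OF assms(1)])
  qed
  moreover have "tamed br J" if "almost_kahler br J"
    using that by (auto simp: almost_kahler_def compatible_with_def tamed_def)
  ultimately show ?thesis by argo
qed

end
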